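(* Let $p$ be a prime, $L$ a field of characteristic $p$ with fixed algebraic closure $\overline{L}$, and $\overline{\mathbb{F}}_p$ the algebraic closure of $\mathbb{F}_p$ in $\overline{L}$. Let $f(x)=c_1x^{d_1}+c_2x^{d_2}\in\overline{\mathbb{F}}_p[x]$ with $c_1,c_2\in\overline{\mathbb{F}}_p^*$, $1\le d_1<d_2$, $d_i=p^{\ell_i}s_i$ with $\ell_i\ge0$, $p\nmid s_i$, and assume $s_2>1$. Let $\alpha,\beta\in L$. Then there are infinitely many $\lambda\in\overline{L}$ such that $f_\lambda^m(\alpha)=\beta$ for some positive integer $m$, where $f_\lambda(x):=f(x)+\lambda$. *)

theory Defs
  imports "HOL-Algebra.Algebraic_Closure_Type"
begin

text \<open>
  The algebraic closure of the prime field inside a field of positive characteristic \<open>p\<close>.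
  There \<open>\<int>\<close>, the image of the integers, is the prime field \<open>F_p\<close>.
\<close>
definition Fp_bar :: "'a::field set" where
  "Fp_bar = {x. \<exists>q. q \<noteq> 0 \<and> (\<forall>i. Polynomial.coeff q i \<in> \<int>) \<and> poly q x = 0}"

definition translate_poly :: "'a::field poly \<Rightarrow> 'a \<Rightarrow> 'a poly" where
  "translate_poly f c = f + [:c:]"

end

theory Submission
  imports Defs
begin

text \<open>
  Write \<open>Q\<^sub>m(\<lambda>) = f\<^sub>\<lambda>\<^sup>m(\<alpha>)\<close> and \<open>R\<^sub>k(\<lambda>) = f\<^sub>\<lambda>\<^sup>k(\<beta>) - \<beta>\<close>, polynomials in \<open>\<lambda>\<close> of degree
  \<open>d\<^sup>m\<^sup>-\<^sup>1\<close> and \<open>d\<^sup>k\<^sup>-\<^sup>1\<close>, where \<open>d \<ge> 2\<close> is the degree of \<open>f\<close>. Modulo \<open>Q\<^sub>m - \<beta>\<close> we have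
  \<open>Q\<^sub>m\<^sub>+\<^sub>k - \<beta> \<equiv> R\<^sub>k\<close>, so a common divisor of \<open>Q\<^sub>m - \<beta>\<close> and \<open>Q\<^sub>m\<^sub>+\<^sub>k - \<beta>\<close> divides \<open>R\<^sub>k\<close>.
  If the polynomials \<open>Q\<^sub>m - \<beta>\<close> had only \<open>n\<close> roots in total, each of them with \<open>m\<close> large would
  have a root of multiplicity exceeding \<open>d\<^sup>n\<close>. Among \<open>n + 1\<close> consecutive such \<open>m\<close> two share this
  root, which contradicts \<open>deg R\<^sub>k \<le> d\<^sup>n\<close> for \<open>0 < k \<le> n\<close>.
\<close>

lemma size_proots_alg_closed:
  fixes p :: "'a::alg_closed_field poly"
  shows "size (proots p) = Polynomial.degree p"
proof (cases "p = 0")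
  case False
  obtain A where A: "size A = Polynomial.degree p"
    and p: "p = smult (lead_coeff p) (\<Prod>x\<in>#A. [:-x, 1:])"
    using alg_closed_imp_factorization[OF False] by blast
  have "proots p = proots (\<Prod>x\<in>#A. [:-x, 1:])"
    using False by (subst p) simp
  also have "\<dots> = A"
    proof (induction A)
    case (add x A)
    have "(\<Prod>y\<in>#A. [:-y, 1:]) \<noteq> 0"
      by (auto simp: prod_mset_zero_iff)
    thus ?case
      using add by (simp add: proots_mult del: mult_pCons_left)
  qed simp
  finally show ?thesis
    using A by simp
qed simp

text \<open>Pigeonhole on multiplicities: over an algebraically closed field the degree is the sum
  of the orders at the roots, and \<open>card S\<close> orders of at most \<open>D\<close> cannot
  reach it.\<close>

lemma exists_order_gt_of_degree_gt:
  fixes p :: "'a::alg_closed_field poly"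
  assumes "Polynomial.degree p > card S * D" "finite S" "{x. poly p x = 0} \<subseteq> S"
  obtains x where "x \<in> S" "Polynomial.order x p > D"
proof -
  have [simp]: "p \<noteq> 0"
    using assms(1) by auto
  have "\<exists>x\<in>S. Polynomial.order x p > D"
  proof (rule ccontr)
    assume "\<not> ?thesis"
    hence le: "\<forall>x\<in>S. Polynomial.order x p \<le> D"
      by (simp add: not_less)
    have "Polynomial.degree p = (\<Sum>x | poly p x = 0. Polynomial.order x p)"
      by (simp add: size_multiset_overloaded_eq flip: size_proots_alg_closed)
    also have "\<dots> \<le> (\<Sum>x\<in>S. Polynomial.order x p)"
      using assms(2,3) by (intro sum_mono2) auto
    also have "\<dots> \<le> card S * D"
      using sum_bounded_above[of S "\<lambda>x. Polynomial.order x p" D] le by simp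
    finally show False
      using assms(1) by simp
  qed
  thus thesis
    using that by blast
qed

text \<open>Composition respects congruence modulo \<open>q - r\<close>; the induction follows
  Horner's scheme for \<open>g\<close>.\<close>

lemma diff_dvd_pcompose_diff:
  fixes g q r :: "'a::comm_ring_1 poly"
  shows "q - r dvd pcompose g q - pcompose g r"
proof (induction g)
  case (pCons a g)
  have "pcompose (pCons a g) q - pcompose (pCons a g) r
      = q * (pcompose g q - pcompose g r) + (q - r) * pcompose g r"
    by (simp add: pcompose_pCons algebra_simps)
  thus ?case
    using pCons.IH by simp
qed simp

text \<open>The indeterminate is the translation parameter, so adding \<open>[:0, 1:]\<close> is the
  translation step.\<close>

fun orbit_poly :: "'a::field poly \<Rightarrow> 'a \<Rightarrow> nat \<Rightarrow> 'a poly" where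
  "orbit_poly g a 0 = [:a:]"
| "orbit_poly g a (Suc m) = pcompose g (orbit_poly g a m) + [:0, 1:]"

lemma poly_orbit_poly:
  "poly (orbit_poly g a m) c = (poly (translate_poly g c) ^^ m) a"
  by (induction m) (auto simp: poly_pcompose translate_poly_def)

lemma degree_orbit_poly_Suc:
  assumes "Polynomial.degree g \<ge> 2"
  shows "Polynomial.degree (orbit_poly g a (Suc m)) = Polynomial.degree g ^ m"
proof (induction m)
  case 0
  show ?case
    by (simp add: pcompose_pCons_0)
next
  case (Suc m)
  have deg: "Polynomial.degree (pcompose g (orbit_poly g a (Suc m))) = Polynomial.degree g ^ Suc m"
    using Suc by (simp add: degree_pcompose del: orbit_poly.simps)
  \<comment> \<open>The composed part has degree above 1, so adding the indeterminate leaves its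
    leading term intact.\<close>
  have "1 < Polynomial.degree g ^ Suc m"
    using assms by (intro one_less_power) auto
  thus ?case
    unfolding orbit_poly.simps(2)[of g a "Suc m"]
    using deg by (subst degree_add_eq_left) auto
qed

lemma degree_orbit_poly_diff:
  assumes "Polynomial.degree g \<ge> 2" "m > 0"
  shows "Polynomial.degree (orbit_poly g a m - [:b:]) = Polynomial.degree g ^ (m - 1)"
proof -
  obtain k where m: "m = Suc k"
    using assms(2) by (cases m) auto
  have "Polynomial.degree (orbit_poly g a m) > 0"
    unfolding m degree_orbit_poly_Suc[OF assms(1)] using assms(1) by simp
  hence "Polynomial.degree (orbit_poly g a m - [:b:]) = Polynomial.degree (orbit_poly g a m)"
    unfolding diff_conv_add_uminus by (intro degree_add_eq_left) simp
  thus ?thesis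
    using degree_orbit_poly_Suc[OF assms(1), of a k] by (simp add: m del: orbit_poly.simps)
qed

text \<open>Modulo \<open>h\<close> the orbit of \<open>a\<close> is at \<open>b\<close> after
  \<open>m\<close> steps, and from there both orbits obey the same recursion.\<close>

lemma dvd_orbit_poly_diff:
  assumes "h dvd orbit_poly g a m - [:b:]"
  shows "h dvd orbit_poly g a (m + k) - orbit_poly g b k"
proof (induction k)
  case 0
  show ?case
    using assms by simp
next
  case (Suc k)
  hence "h dvd pcompose g (orbit_poly g a (m + k)) - pcompose g (orbit_poly g b k)"
    by (rule dvd_trans[OF _ diff_dvd_pcompose_diff])
  thus ?case
    by simp
qed

lemma common_dvd_orbit_poly_diff:
  assumes "h dvd orbit_poly g a m - [:b:]" "h dvd orbit_poly g a (m + k) - [:b:]"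
  shows "h dvd orbit_poly g b k - [:b:]"
proof -
  have "h dvd (orbit_poly g a (m + k) - [:b:]) - (orbit_poly g a (m + k) - orbit_poly g b k)"
    by (rule dvd_diff[OF assms(2) dvd_orbit_poly_diff[OF assms(1)]])
  also have "\<dots> = orbit_poly g b k - [:b:]"
    by (simp add: algebra_simps)
  finally show ?thesis .
qed

theorem infinite_parameters_orbit_hits:
  fixes g :: "'a::alg_closed_field poly"
  assumes deg: "Polynomial.degree g \<ge> 2"
  shows "infinite {c. \<exists>m>0. (poly (translate_poly g c) ^^ m) a = b}"
proof
  define S where "S = {c. \<exists>m>0. (poly (translate_poly g c) ^^ m) a = b}"
  assume "finite {c. \<exists>m>0. (poly (translate_poly g c) ^^ m) a = b}"
  hence fin: "finite S"
    by (simp add: S_def)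
  define n where "n = card S"
  define d where "d = Polynomial.degree g"
  define P where "P = (\<lambda>m. orbit_poly g a m - [:b:])"
  \<comment> \<open>From \<open>m - 1 \<ge> 2 * n\<close> the degree of \<open>P m\<close> is at
    least \<open>d ^ (2 * n)\<close>, which exceeds \<open>n * d ^ n\<close>. The
    \<open>n + 1\<close> indices outnumber \<open>S\<close>, yet any two differ by at most
    \<open>n\<close>.\<close>
  define I where "I = {Suc (2 * n)..Suc (3 * n)}"
  have d: "d \<ge> 2"
    using deg by (simp add: d_def)
  have degP: "Polynomial.degree (orbit_poly g x m - [:b:]) = d ^ (m - 1)" if "m > 0" for x m
    unfolding d_def by (rule degree_orbit_poly_diff[OF deg that])
  have "\<exists>x\<in>S. Polynomial.order x (P m) > d ^ n" if "m \<in> I" for m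
  proof -
    have "n < 2 ^ n"
      by simp
    also have "\<dots> \<le> d ^ n"
      using d by (intro power_mono) auto
    finally have "n * d ^ n < d ^ n * d ^ n"
      using d by simp
    also have "\<dots> = d ^ (2 * n)"
      by (simp add: mult_2 power_add)
    also have "\<dots> \<le> d ^ (m - 1)"
      using d that by (intro power_increasing) (auto simp: I_def)
    also have "\<dots> = Polynomial.degree (P m)"
      using that by (simp add: P_def degP I_def)
    finally have gt: "Polynomial.degree (P m) > card S * d ^ n"
      by (simp add: n_def)
    have "{x. poly (P m) x = 0} \<subseteq> S"
      using that by (auto simp: P_def S_def I_def poly_orbit_poly intro!: exI[of _ m])
    from exists_order_gt_of_degree_gt[OF gt fin this] show ?thesis
      by blast
  qed
  then obtain r where r: "\<And>m. m \<in> I \<Longrightarrow> r m \<in> S"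
    and ord: "\<And>m. m \<in> I \<Longrightarrow> Polynomial.order (r m) (P m) > d ^ n"
    by metis
  have "\<not> inj_on r I"
  proof
    assume "inj_on r I"
    hence "card I \<le> card S"
      using r fin by (intro card_inj_on_le[of r]) auto
    thus False
      by (simp add: I_def n_def)
  qed
  then obtain i j where ij: "i \<in> I" "j \<in> I" "i < j" "r i = r j"
    by (metis inj_onI linorder_neqE_nat)
  define h where "h = [:- r i, 1:] ^ Suc (d ^ n)"
  have "h dvd P m" if "m \<in> I" "r m = r i" for m
    unfolding h_def using order_1[of "r i" "P m"] ord[OF that(1)] that(2)
    by (metis Suc_leI le_imp_power_dvd dvd_trans)
  hence "h dvd P i" "h dvd P (i + (j - i))"
    using ij by auto
  hence "h dvd orbit_poly g b (j - i) - [:b:]"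
    unfolding P_def by (rule common_dvd_orbit_poly_diff)
  moreover have deg_R: "Polynomial.degree (orbit_poly g b (j - i) - [:b:]) = d ^ (j - i - 1)"
    using ij by (intro degP) simp
  \<comment> \<open>As \<open>j - i > 0\<close>, the degree is a power of \<open>d\<close> and hence
    positive or the polynomial is a nonzero constant by degree count: \<open>0\<close> would need
    \<open>d ^ (j - i - 1) = 0\<close>.\<close>
  moreover have "orbit_poly g b (j - i) - [:b:] \<noteq> 0"
  proof
    define k where "k = j - i"
    assume "orbit_poly g b (j - i) - [:b:] = 0"
    hence "Polynomial.degree (orbit_poly g b k - [:b:]) = 0"
      by (simp add: k_def)
    thus False
      using deg_R d by (simp add: k_def)
  qed
  ultimately have "Polynomial.degree h \<le> d ^ (j - i - 1)"
    using dvd_imp_degree_le by metis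
  also have "\<dots> \<le> d ^ n"
    using d ij by (intro power_increasing) (auto simp: I_def)
  finally show False
    by (simp add: h_def degree_linear_power del: power_Suc)
qed

theorem theorem5p6:
  fixes p d\<^sub>1 d\<^sub>2 l\<^sub>1 l\<^sub>2 s\<^sub>1 s\<^sub>2 :: nat
    and c\<^sub>1 c\<^sub>2 :: "'L::field alg_closure"
    and f :: "'L alg_closure poly"
    and \<alpha> \<beta> :: 'L
  assumes "prime p"
    and "CHAR('L) = p"
    and "c\<^sub>1 \<in> Fp_bar" "c\<^sub>1 \<noteq> 0"
    and "c\<^sub>2 \<in> Fp_bar" "c\<^sub>2 \<noteq> 0"
    and "f = Polynomial.monom c\<^sub>1 d\<^sub>1 + Polynomial.monom c\<^sub>2 d\<^sub>2"
    and "1 \<le> d\<^sub>1" "d\<^sub>1 < d\<^sub>2"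
    and "d\<^sub>1 = p ^ l\<^sub>1 * s\<^sub>1" "\<not> p dvd s\<^sub>1"
    and "d\<^sub>2 = p ^ l\<^sub>2 * s\<^sub>2" "\<not> p dvd s\<^sub>2"
    and "s\<^sub>2 > 1"
  shows "infinite {c :: 'L alg_closure.
           \<exists>m::nat. m > 0 \<and> (poly (translate_poly f c) ^^ m) (to_ac \<alpha>) = to_ac \<beta>}"
proof -
  have "Polynomial.degree (Polynomial.monom c\<^sub>1 d\<^sub>1) < Polynomial.degree (Polynomial.monom c\<^sub>2 d\<^sub>2)"
    using \<open>c\<^sub>1 \<noteq> 0\<close> \<open>c\<^sub>2 \<noteq> 0\<close> \<open>d\<^sub>1 < d\<^sub>2\<close> by (simp add: Polynomial.degree_monom_eq)
  hence "Polynomial.degree f = d\<^sub>2"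
    unfolding \<open>f = _\<close> using \<open>c\<^sub>2 \<noteq> 0\<close> by (simp add: degree_add_eq_right Polynomial.degree_monom_eq)
  with \<open>1 \<le> d\<^sub>1\<close> \<open>d\<^sub>1 < d\<^sub>2\<close> show ?thesis
    by (intro infinite_parameters_orbit_hits) simp
qed

end
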